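(* Let $p\ge 4$ be an integer. Then $\bar d(K(p,p,q))=2$ if either $p$ is even and $p+2\le q\le \Phi_{even}(p)+2$, or $p$ is odd and $p+3\le q\le \Phi_{odd}(p)+2$.
   Context: $K(p,p,q)$ is the complete tripartite graph with partite sets of sizes $p,p,q$. The orientation number $\bar d(G)$ of a connected bridgeless graph $G$ is the minimum of the diameter $d(D)$ over all strong orientations $D$ of $G$, where $d(D)$ is the maximum over ordered pairs of vertices of the length of a shortest directed path. For even $p$, $\Phi_{even}(p)=\sum\binom{p/2}{x_1}\binom{p/2}{x_2}\binom{p/2}{x_3}\binom{p/2}{x_4}$ over all integer tuples with $x_1+x_2+x_3+x_4=p$ and $1\le x_r\le p/2-1$ for all $r$; equivalently $\Phi_{even}(p)=\binom{2p}{p}-8\binom{3p/2}{p}+12\binom{p}{p/2}-6$. For odd $p$, with $x=\lfloor p/2\rfloor$, $\Phi_{odd}(p)=\sum\binom{x+1}{x_1}\binom{x+1}{x_2}\binom{x}{x_3}\binom{x}{x_4}$ over all integer tuples $(x_1,x_2,x_3,x_4)$ with $x_1+x_2+x_3+x_4=p$, $1\le x_1,x_2\le x$, and $1\le x_3,x_4\le x-1$. *)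

theory Defs
  imports "Graph_Theory.Graph_Theory"
begin

text \<open>
  Undirected graphs are symmetric digraphs (locale \<^locale>\<open>pair_graph\<close>): an edge \<open>uv\<close> is the
  pair of arcs \<open>(u,v)\<close>, \<open>(v,u)\<close>. The vertex \<open>(i,j)\<close> below is the \<open>j\<close>-th vertex of the \<open>i\<close>-th
  partite set, which has \<open>ns ! i\<close> elements.
\<close>

definition complete_multipartite :: "nat list \<Rightarrow> (nat \<times> nat) pair_pre_digraph" where
  "complete_multipartite ns =
    (let V = {(i, j). i < length ns \<and> j < ns ! i}
     in \<lparr> pverts = V, parcs = {(u, v). u \<in> V \<and> v \<in> V \<and> fst u \<noteq> fst v} \<rparr>)"

lemma finite_pverts_complete_multipartite: "finite (pverts (complete_multipartite ns))"
proof -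
  have "pverts (complete_multipartite ns) = (SIGMA i:{..<length ns}. {..<ns ! i})"
    by (auto simp: complete_multipartite_def Let_def)
  then show ?thesis by simp
qed

lemma pair_graph_complete_multipartite: "pair_graph (complete_multipartite ns)"
proof -
  let ?G = "complete_multipartite ns"
  have "parcs ?G \<subseteq> pverts ?G \<times> pverts ?G"
    by (auto simp: complete_multipartite_def Let_def)
  then have "finite (parcs ?G)"
    by (rule finite_subset) (simp add: finite_pverts_complete_multipartite)
  then show ?thesis
    using finite_pverts_complete_multipartite[of ns]
    by unfold_locales
      (auto simp: complete_multipartite_def Let_def symmetric_def sym_def)
qed

definition orientation_of :: "'a pair_pre_digraph \<Rightarrow> 'a pair_pre_digraph \<Rightarrow> bool" where
  "orientation_of D G \<longleftrightarrow>
    pverts D = pverts G \<and>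
    parcs D \<union> (parcs D)\<inverse> = parcs G \<and> parcs D \<inter> (parcs D)\<inverse> = {}"

definition strong_orientation_of :: "'a pair_pre_digraph \<Rightarrow> 'a pair_pre_digraph \<Rightarrow> bool" where
  "strong_orientation_of D G \<longleftrightarrow> orientation_of D G \<and> strongly_connected (with_proj D)"

text \<open>
  With unit arc weights, \<^const>\<open>wf_digraph.\<mu>\<close> is the length of a shortest directed path
  (\<open>\<infinity>\<close> if there is none).
\<close>

definition diameter :: "'a pair_pre_digraph \<Rightarrow> ereal" where
  "diameter D = (SUP (u, v) \<in> pverts D \<times> pverts D. wf_digraph.\<mu> (with_proj D) (\<lambda>_. 1) u v)"

text \<open>For finite \<open>G\<close> the infimum is a minimum, see \<open>orientation_number_attained\<close>.\<close>

definition orientation_number :: "'a pair_pre_digraph \<Rightarrow> ereal" where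
  "orientation_number G = (INF D \<in> {D. strong_orientation_of D G}. diameter D)"

lemma finite_strong_orientations:
  assumes "finite (parcs G)"
  shows "finite {D. strong_orientation_of D G}"
proof (rule finite_subset)
  show "{D. strong_orientation_of D G} \<subseteq>
      (\<lambda>A. \<lparr> pverts = pverts G, parcs = A \<rparr>) ` Pow (parcs G)"
  proof
    fix D assume "D \<in> {D. strong_orientation_of D G}"
    then have "D = \<lparr> pverts = pverts G, parcs = parcs D \<rparr>" "parcs D \<in> Pow (parcs G)"
      by (auto simp: strong_orientation_of_def orientation_of_def)
    then show "D \<in> (\<lambda>A. \<lparr> pverts = pverts G, parcs = A \<rparr>) ` Pow (parcs G)"
      by (rule image_eqI)
  qed
qed (simp add: assms)

lemma orientation_number_attained:
  assumes "finite (parcs G)" and "strong_orientation_of D\<^sub>0 G"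
  shows "\<exists>D. strong_orientation_of D G \<and> orientation_number G = diameter D"
proof -
  have "(INF D \<in> {D. strong_orientation_of D G}. diameter D)
      \<in> diameter ` {D. strong_orientation_of D G}"
    using assms by (intro finite_INF_in finite_strong_orientations) auto
  then show ?thesis by (auto simp: orientation_number_def)
qed

definition Phi_even :: "nat \<Rightarrow> nat" where
  "Phi_even p =
    (let h = p div 2 in
      \<Sum>(x\<^sub>1, x\<^sub>2, x\<^sub>3, x\<^sub>4) \<in> {(x\<^sub>1, x\<^sub>2, x\<^sub>3, x\<^sub>4).
          x\<^sub>1 + x\<^sub>2 + x\<^sub>3 + x\<^sub>4 = p \<and>
          x\<^sub>1 \<in> {1..h - 1} \<and> x\<^sub>2 \<in> {1..h - 1} \<and> x\<^sub>3 \<in> {1..h - 1} \<and> x\<^sub>4 \<in> {1..h - 1}}.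
        (h choose x\<^sub>1) * (h choose x\<^sub>2) * (h choose x\<^sub>3) * (h choose x\<^sub>4))"

definition Phi_odd :: "nat \<Rightarrow> nat" where
  "Phi_odd p =
    (let x = p div 2 in
      \<Sum>(x\<^sub>1, x\<^sub>2, x\<^sub>3, x\<^sub>4) \<in> {(x\<^sub>1, x\<^sub>2, x\<^sub>3, x\<^sub>4).
          x\<^sub>1 + x\<^sub>2 + x\<^sub>3 + x\<^sub>4 = p \<and>
          x\<^sub>1 \<in> {1..x} \<and> x\<^sub>2 \<in> {1..x} \<and> x\<^sub>3 \<in> {1..x - 1} \<and> x\<^sub>4 \<in> {1..x - 1}}.
        ((x + 1) choose x\<^sub>1) * ((x + 1) choose x\<^sub>2) * (x choose x\<^sub>3) * (x choose x\<^sub>4))"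

end

theory Submission
  imports Defs
begin

text \<open>
  Split the partite sets \<open>A\<close> and \<open>B\<close> of size \<open>p = m + n\<close> into blocks \<open>A\<^sub>1\<close>, \<open>B\<^sub>1\<close> of size \<open>m\<close> and
  \<open>A\<^sub>2\<close>, \<open>B\<^sub>2\<close> of size \<open>n\<close>, where \<open>m \<in> {n, n + 1}\<close>, and orient
  \<open>A\<^sub>1 \<rightarrow> B\<^sub>1 \<rightarrow> A\<^sub>2 \<rightarrow> B\<^sub>2 \<rightarrow> A\<^sub>1\<close>. A vertex of the third partite set is determined by its
  out-neighbourhood \<open>X \<subseteq> A \<union> B\<close>; distinct sets \<open>X\<close> of size \<open>p\<close> form an antichain, so these
  vertices are at distance two from each other. If \<open>X\<close> meets every block and contains none, then its
  vertex is within distance two of all of \<open>A \<union> B\<close>, in both directions, and \<open>\<Phi>\<close> counts these \<open>X\<close>.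
  The sets \<open>A\<close> and \<open>B\<close> are also admissible and give the paths between \<open>A\<close> and \<open>B\<close>; distinct
  vertices within a block are joined through \<open>m\<close> further sets that separate the points of each block.
\<close>

section \<open>Blocks, orientations from set families, and admissible sets\<close>

definition pairs :: "nat \<Rightarrow> (nat \<times> nat) set" where
  "pairs p = {0, 1} \<times> {..<p}"

text \<open>\<open>side p 0\<close> and \<open>side p 1\<close> serve as the partite sets A and B,
  and \<open>side q 2\<close> as the third one.\<close>

definition side :: "nat \<Rightarrow> nat \<Rightarrow> (nat \<times> nat) set" where
  "side p i = {i} \<times> {..<p}"

text \<open>The truth value of \<open>snd u < m\<close> names the block of \<open>u\<close> within
  its row. Arcs leaving row 0 keep this value and arcs leaving row 1 flip it, which produces the
  directed 4-cycle of blocks.\<close>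

definition block_arc :: "nat \<Rightarrow> nat \<times> nat \<Rightarrow> nat \<times> nat \<Rightarrow> bool" where
  "block_arc m u v \<longleftrightarrow>
    fst u = 0 \<and> fst v = 1 \<and> (snd u < m \<longleftrightarrow> snd v < m) \<or>
    fst u = 1 \<and> fst v = 0 \<and> (snd u < m \<longleftrightarrow> \<not> snd v < m)"

definition family_digraph ::
    "nat \<Rightarrow> nat \<Rightarrow> nat \<Rightarrow> (nat \<Rightarrow> (nat \<times> nat) set) \<Rightarrow> (nat \<times> nat) pair_pre_digraph" where
  "family_digraph m p q f =
    \<lparr> pverts = pairs p \<union> side q 2,
      parcs = {(u, v). u \<in> pairs p \<and> v \<in> pairs p \<and> block_arc m u v}
        \<union> {((2, k), v) | k v. k < q \<and> v \<in> f k}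
        \<union> {(v, (2, k)) | k v. k < q \<and> v \<in> pairs p - f k} \<rparr>"

text \<open>The Boolean \<open>b\<close> selects the block of row \<open>i\<close>, so one formula
  treats all four blocks.\<close>

definition balanced_sets :: "nat \<Rightarrow> nat \<Rightarrow> (nat \<times> nat) set set" where
  "balanced_sets m n =
    {X. X \<subseteq> pairs (m + n) \<and> card X = m + n \<and>
      (\<forall>i\<in>{0, 1}. \<forall>b.
        (\<exists>j. (i, j) \<in> X \<and> (j < m \<longleftrightarrow> b)) \<and> (\<exists>j<m + n. (i, j) \<notin> X \<and> (j < m \<longleftrightarrow> b)))}"

section \<open>Diameter two\<close>

lemma diameter_le_2:
  fixes D :: "'a pair_pre_digraph"
  assumes wf: "wf_digraph (with_proj D)"
    and path: "\<And>u v. u \<in> pverts D \<Longrightarrow> v \<in> pverts D \<Longrightarrow> u \<noteq> v \<Longrightarrow>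
      (u, v) \<in> parcs D \<or> (\<exists>w. (u, w) \<in> parcs D \<and> (w, v) \<in> parcs D)"
  shows "diameter D \<le> 2"
proof -
  interpret wf_digraph "with_proj D" by (rule wf)
  have "\<mu> (\<lambda>_. 1) u v \<le> 2" if uv: "u \<in> pverts D" "v \<in> pverts D" for u v
  proof -
    have "\<exists>es. awalk u es v \<and> length es \<le> 2"
    proof (cases "u = v")
      case True
      then have "awalk u [] v" using uv by (simp add: awalk_def)
      then show ?thesis by (intro exI[of _ "[]"]) simp
    next
      case False
      from path[OF uv False] show ?thesis
      proof
        assume "(u, v) \<in> parcs D"
        then have "awalk u [(u, v)] v" using uv by (simp add: awalk_def)
        then show ?thesis by (intro exI[of _ "[(u, v)]"]) simp
      next
        assume "\<exists>w. (u, w) \<in> parcs D \<and> (w, v) \<in> parcs D"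
        then obtain w where "(u, w) \<in> parcs D" "(w, v) \<in> parcs D" by blast
        then have "awalk u [(u, w), (w, v)] v" using uv by (simp add: awalk_def)
        then show ?thesis by (intro exI[of _ "[(u, w), (w, v)]"]) simp
      qed
    qed
    then obtain es where es: "awalk u es v" "length es \<le> 2" by blast
    have "\<mu> (\<lambda>_. 1) u v \<le> ereal (awalk_cost (\<lambda>_. 1) es)"
      by (rule min_cost_le_walk_cost[OF es(1)])
    also have "\<dots> \<le> 2"
      using es(2) by (simp add: awalk_cost_def sum_list_triv)
    finally show ?thesis .
  qed
  then show ?thesis
    unfolding diameter_def by (intro SUP_least) auto
qed

lemma strongly_connected_if_two_step:
  fixes D :: "'a pair_pre_digraph"
  assumes wf: "wf_digraph (with_proj D)" and "pverts D \<noteq> {}"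
    and path: "\<And>u v. u \<in> pverts D \<Longrightarrow> v \<in> pverts D \<Longrightarrow> u \<noteq> v \<Longrightarrow>
      (u, v) \<in> parcs D \<or> (\<exists>w. (u, w) \<in> parcs D \<and> (w, v) \<in> parcs D)"
  shows "strongly_connected (with_proj D)"
proof -
  interpret wf_digraph "with_proj D" by (rule wf)
  have "u \<rightarrow>\<^sup>*\<^bsub>with_proj D\<^esub> v" if uv: "u \<in> pverts D" "v \<in> pverts D" for u v
  proof (cases "u = v")
    case True
    then show ?thesis using uv by simp
  next
    case False
    from path[OF uv False] show ?thesis
      by (metis adj_reachable_trans reachable_adjI with_proj_simps(3))
  qed
  then show ?thesis using assms(2) by (auto simp: strongly_connected_def)
qed

lemma wf_digraph_orientation:
  assumes "pair_graph G" and "orientation_of D G"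
  shows "wf_digraph (with_proj D)"
proof -
  interpret G: pair_graph G by (rule assms(1))
  have "parcs D \<subseteq> parcs G" "pverts D = pverts G"
    using assms(2) by (auto simp: orientation_of_def)
  then show ?thesis
    unfolding wf_digraph_wp_iff using G.wellformed' by unfold_locales auto
qed

text \<open>An orientation keeps only one of the two arcs of an edge; along the discarded arc
  \<open>(a, b)\<close> no walk has length 0 or 1.\<close>

lemma diameter_orientation_ge_2:
  assumes G: "pair_graph G" and arc: "(u, v) \<in> parcs G" and D: "strong_orientation_of D G"
  shows "2 \<le> diameter D"
proof -
  interpret G: pair_graph G by (rule G)
  have or: "pverts D = pverts G" "parcs D \<union> (parcs D)\<inverse> = parcs G" "parcs D \<inter> (parcs D)\<inverse> = {}"
    using D by (auto simp: strong_orientation_of_def orientation_of_def)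
  interpret wf_digraph "with_proj D"
    using wf_digraph_orientation[OF G] D by (simp add: strong_orientation_of_def)
  obtain a b where ab: "(a, b) \<in> parcs G" "(a, b) \<notin> parcs D"
    using or arc by blast
  then have ne: "a \<noteq> b" and V: "a \<in> pverts D" "b \<in> pverts D"
    using G.no_loops' G.wellformed' or(1) by auto
  have "2 \<le> \<mu> (\<lambda>_. 1) a b"
    unfolding \<mu>_def
  proof (rule INF_greatest)
    fix es assume "es \<in> {es. awalk a es b}"
    then have w: "awalk a es b" by simp
    have "length es \<ge> 2"
    proof (rule ccontr)
      assume "\<not> length es \<ge> 2"
      then consider "es = []" | e where "es = [e]"
        by (cases es; cases "tl es") auto
      then show False
        using w ne ab by cases (auto simp: awalk_def)
    qed
    then show "2 \<le> ereal (awalk_cost (\<lambda>_. 1) es)"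
      by (simp add: awalk_cost_def sum_list_triv)
  qed
  also have "\<dots> \<le> diameter D"
    unfolding diameter_def using V by (intro SUP_upper2[of "(a, b)"]) auto
  finally show ?thesis .
qed

section \<open>The orientation given by a family of sets\<close>

text \<open>The kinds of the two ends decide the middle vertex. \<open>sep\<close> gives a vertex of
  the third set between two vertices of A and B, \<open>antichain\<close> a vertex of A or B between
  two vertices of the third set, and \<open>into\<close> and \<open>out\<close> settle the mixed
  pairs. The pairs excluded from \<open>sep\<close>, in different blocks of one partite set, use the
  block cycle.\<close>

lemma family_digraph_two_step:
  assumes sub: "\<And>k. k < q \<Longrightarrow> f k \<subseteq> pairs p"
    and antichain: "\<And>k l. k < q \<Longrightarrow> l < q \<Longrightarrow> k \<noteq> l \<Longrightarrow> \<not> f k \<subseteq> f l"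
    and into: "\<And>k w. k < q \<Longrightarrow> w \<in> pairs p - f k \<Longrightarrow> \<exists>w'\<in>f k. block_arc m w' w"
    and out: "\<And>k w. k < q \<Longrightarrow> w \<in> f k \<Longrightarrow> \<exists>w'\<in>pairs p - f k. block_arc m w w'"
    and sep: "\<And>u v. u \<in> pairs p \<Longrightarrow> v \<in> pairs p \<Longrightarrow> u \<noteq> v \<Longrightarrow>
      \<not> (fst u = fst v \<and> (snd u < m) \<noteq> (snd v < m)) \<Longrightarrow> \<exists>k<q. u \<notin> f k \<and> v \<in> f k"
    and m: "0 < m" "m < p"
    and uv: "u \<in> pverts (family_digraph m p q f)" "v \<in> pverts (family_digraph m p q f)" "u \<noteq> v"
  defines "E \<equiv> parcs (family_digraph m p q f)"
  shows "(u, v) \<in> E \<or> (\<exists>w. (u, w) \<in> E \<and> (w, v) \<in> E)"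
proof -
  have E_block: "(a, b) \<in> E" if "a \<in> pairs p" "b \<in> pairs p" "block_arc m a b" for a b
    using that by (auto simp: E_def family_digraph_def)
  have E_out: "((2, k), a) \<in> E" if "k < q" "a \<in> f k" for a k
    using that by (cases a) (auto simp: E_def family_digraph_def)
  have E_in: "(a, (2, k)) \<in> E" if "k < q" "a \<in> pairs p - f k" for a k
    using that by (cases a) (auto simp: E_def family_digraph_def)
  from uv(1) consider (u1) "u \<in> pairs p" | (u2) k where "u = (2, k)" "k < q"
    by (auto simp: family_digraph_def side_def)
  then show ?thesis
  proof cases
    case u1
    from uv(2) consider (v1) "v \<in> pairs p" | (v2) l where "v = (2, l)" "l < q"
      by (auto simp: family_digraph_def side_def)
    then show ?thesis
    proof cases
      case v1
      show ?thesis
      proof (cases "fst u = fst v \<and> (snd u < m) \<noteq> (snd v < m)")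
        case True
        \<comment> \<open>\<open>w\<close> is the first vertex, in column 0 or \<open>m\<close>, of
          the block that follows that of \<open>u\<close> on the cycle. One further step on the
          cycle reaches the block of \<open>v\<close>.\<close>
        define w :: "nat \<times> nat" where
          "w = (1 - fst u, if (snd u < m) = (fst u = 0) then 0 else m)"
        have "w \<in> pairs p" "block_arc m u w" "block_arc m w v"
          using True u1 v1 m by (auto simp: w_def pairs_def block_arc_def split: if_splits)
        then show ?thesis using E_block u1 v1 by blast
      next
        case False
        then obtain k where "k < q" "u \<notin> f k" "v \<in> f k" using sep u1 v1 uv(3) by blast
        then show ?thesis using E_in E_out u1 by blast
      qed
    next
      case v2
      show ?thesis
      proof (cases "u \<in> f l")
        case True
        then obtain w where "w \<in> pairs p - f l" "block_arc m u w" using out v2 by blast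
        then show ?thesis using E_block E_in u1 v2 by blast
      next
        case False
        then show ?thesis using E_in u1 v2 by blast
      qed
    qed
  next
    case u2
    from uv(2) consider (v1) "v \<in> pairs p" | (v2) l where "v = (2, l)" "l < q"
      by (auto simp: family_digraph_def side_def)
    then show ?thesis
    proof cases
      case v1
      show ?thesis
      proof (cases "v \<in> f k")
        case True
        then show ?thesis using E_out u2 by blast
      next
        case False
        then obtain w where "w \<in> f k" "block_arc m w v" using into u2 v1 by blast
        then show ?thesis using E_block E_out u2 v1 sub by blast
      qed
    next
      case v2
      then obtain w where "w \<in> f k" "w \<notin> f l" using antichain u2 uv(3) by blast
      then show ?thesis using E_in E_out u2 v2 sub by blast
    qed
  qed
qed

lemma orientation_of_family_digraph:
  assumes sub: "\<And>k. k < q \<Longrightarrow> f k \<subseteq> pairs p"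
  shows "orientation_of (family_digraph m p q f) (complete_multipartite [p, p, q])"
proof -
  let ?D = "family_digraph m p q f" and ?G = "complete_multipartite [p, p, q]"
  have V: "pverts ?G = pairs p \<union> side q 2"
    by (auto simp: complete_multipartite_def pairs_def side_def less_Suc_eq numeral_3_eq_3 nth_Cons
        split: nat.splits)
  have arcs_G: "parcs ?G =
      {(u, v). u \<in> pairs p \<union> side q 2 \<and> v \<in> pairs p \<union> side q 2 \<and> fst u \<noteq> fst v}"
    using V by (simp add: complete_multipartite_def Let_def)
  have sub': "fst v \<noteq> 2" if "v \<in> pairs p" for v
    using that by (auto simp: pairs_def)
  have "parcs ?D \<union> (parcs ?D)\<inverse> = parcs ?G"
  proof (intro equalityI subsetI)
    fix e assume e: "e \<in> parcs ?D \<union> (parcs ?D)\<inverse>"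
    then show "e \<in> parcs ?G"
      using sub sub' unfolding arcs_G
      by (fastforce simp: family_digraph_def block_arc_def side_def)
  next
    fix e assume "e \<in> parcs ?G"
    then obtain u v where e: "e = (u, v)"
      and "u \<in> pairs p \<union> side q 2" "v \<in> pairs p \<union> side q 2" "fst u \<noteq> fst v"
      unfolding arcs_G by blast
    then consider "u \<in> pairs p" "v \<in> pairs p" | k where "u \<in> pairs p" "v = (2, k)" "k < q"
      | k where "v \<in> pairs p" "u = (2, k)" "k < q"
      by (auto simp: side_def)
    then show "e \<in> parcs ?D \<union> (parcs ?D)\<inverse>"
    proof cases
      case 1
      \<comment> \<open>Equal block indices direct the edge from row 0 to row 1, different ones from
        row 1 to row 0.\<close>
      then have "block_arc m u v \<or> block_arc m v u"
        using \<open>fst u \<noteq> fst v\<close> by (auto simp: pairs_def block_arc_def)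
      then show ?thesis using 1 e by (auto simp: family_digraph_def)
    next
      case 2
      then show ?thesis by (cases u; cases "u \<in> f k") (auto simp: e family_digraph_def)
    next
      case 3
      then show ?thesis by (cases v; cases "v \<in> f k") (auto simp: e family_digraph_def)
    qed
  qed
  moreover have "parcs ?D \<inter> (parcs ?D)\<inverse> = {}"
    using sub sub' by (fastforce simp: family_digraph_def block_arc_def)
  ultimately show ?thesis
    using V by (simp add: orientation_of_def family_digraph_def)
qed

text \<open>Enumerating \<open>F\<close> assigns one set to each vertex of the third partite set.
  The resulting orientation gives the upper bound; the lower bound holds for every strong
  orientation, since the graph has an edge.\<close>

lemma orientation_number_eq_2:
  assumes F: "finite F" "card F = q" "\<And>X. X \<in> F \<Longrightarrow> X \<subseteq> pairs p"
    and antichain: "\<And>X Y. X \<in> F \<Longrightarrow> Y \<in> F \<Longrightarrow> X \<noteq> Y \<Longrightarrow> \<not> X \<subseteq> Y"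
    and into: "\<And>X w. X \<in> F \<Longrightarrow> w \<in> pairs p - X \<Longrightarrow> \<exists>w'\<in>X. block_arc m w' w"
    and out: "\<And>X w. X \<in> F \<Longrightarrow> w \<in> X \<Longrightarrow> \<exists>w'\<in>pairs p - X. block_arc m w w'"
    and sep: "\<And>u v. u \<in> pairs p \<Longrightarrow> v \<in> pairs p \<Longrightarrow> u \<noteq> v \<Longrightarrow>
      \<not> (fst u = fst v \<and> (snd u < m) \<noteq> (snd v < m)) \<Longrightarrow> \<exists>X\<in>F. u \<notin> X \<and> v \<in> X"
    and m: "0 < m" "m < p"
  shows "orientation_number (complete_multipartite [p, p, q]) = 2"
proof -
  let ?G = "complete_multipartite [p, p, q]"
  obtain f where f: "bij_betw f {0..<q} F"
    using ex_bij_betw_nat_finite[OF F(1)] F(2) by blast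
  then have fF: "f k \<in> F" if "k < q" for k
    using that by (auto simp: bij_betw_def)
  have f_inj: "f k \<noteq> f l" if "k < q" "l < q" "k \<noteq> l" for k l
    using f that by (auto simp: bij_betw_def inj_on_def)
  have f_onto: "\<exists>k<q. X = f k" if "X \<in> F" for X
    using f that by (force simp: bij_betw_def)
  let ?D = "family_digraph m p q f"
  have or: "orientation_of ?D ?G"
    using fF F(3) by (intro orientation_of_family_digraph) blast
  have wf: "wf_digraph (with_proj ?D)"
    by (rule wf_digraph_orientation[OF pair_graph_complete_multipartite or])
  have step: "(u, v) \<in> parcs ?D \<or> (\<exists>w. (u, w) \<in> parcs ?D \<and> (w, v) \<in> parcs ?D)"
    if "u \<in> pverts ?D" "v \<in> pverts ?D" "u \<noteq> v" for u v
  proof (rule family_digraph_two_step[OF _ _ _ _ _ m that])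
    show "\<exists>k<q. u \<notin> f k \<and> v \<in> f k"
      if "u \<in> pairs p" "v \<in> pairs p" "u \<noteq> v" "\<not> (fst u = fst v \<and> (snd u < m) \<noteq> (snd v < m))"
      for u v
      using sep[OF that] f_onto by metis
    show "f k \<subseteq> pairs p" if "k < q" for k
      by (rule F(3)[OF fF[OF that]])
    show "\<not> f k \<subseteq> f l" if "k < q" "l < q" "k \<noteq> l" for k l
      by (rule antichain[OF fF fF f_inj]) (use that in auto)
    show "\<exists>w'\<in>f k. block_arc m w' w" if "k < q" "w \<in> pairs p - f k" for k w
      by (rule into[OF fF[OF that(1)] that(2)])
    show "\<exists>w'\<in>pairs p - f k. block_arc m w w'" if "k < q" "w \<in> f k" for k w
      by (rule out[OF fF[OF that(1)] that(2)])
  qed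
  have "(0, 0) \<in> pverts ?D"
    using m by (auto simp: family_digraph_def pairs_def)
  then have "strong_orientation_of ?D ?G"
    using or strongly_connected_if_two_step[OF wf _ step] by (auto simp: strong_orientation_of_def)
  moreover have "diameter ?D \<le> 2"
    by (rule diameter_le_2[OF wf step])
  ultimately have "orientation_number ?G \<le> 2"
    unfolding orientation_number_def by (intro INF_lower2[of ?D]) auto
  moreover have "((0, 0), (1, 0)) \<in> parcs ?G"
    using m by (auto simp: complete_multipartite_def)
  then have "2 \<le> orientation_number ?G"
    unfolding orientation_number_def
    using diameter_orientation_ge_2[OF pair_graph_complete_multipartite] by (intro INF_greatest) auto
  ultimately show ?thesis by (rule antisym)
qed

section \<open>Counting balanced sets\<close>

lemma finite_balanced_sets: "finite (balanced_sets m n)"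
proof (rule finite_subset)
  show "balanced_sets m n \<subseteq> Pow (pairs (m + n))" by (auto simp: balanced_sets_def)
qed (simp add: pairs_def)

text \<open>A set is assembled from its traces on A1, B1, A2, B2, in this order, of sizes
  \<open>x\<^sub>1\<close> to \<open>x\<^sub>4\<close>. A trace size strictly between 0 and the
  block size forces the set to meet the block and to miss a point of it.\<close>

lemma card_balanced_sets_ge:
  "(\<Sum>(x\<^sub>1, x\<^sub>2, x\<^sub>3, x\<^sub>4) \<in> {(x\<^sub>1, x\<^sub>2, x\<^sub>3, x\<^sub>4). x\<^sub>1 + x\<^sub>2 + x\<^sub>3 + x\<^sub>4 = m + n \<and>
        x\<^sub>1 \<in> {1..m - 1} \<and> x\<^sub>2 \<in> {1..m - 1} \<and> x\<^sub>3 \<in> {1..n - 1} \<and> x\<^sub>4 \<in> {1..n - 1}}.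
      (m choose x\<^sub>1) * (m choose x\<^sub>2) * (n choose x\<^sub>3) * (n choose x\<^sub>4))
    \<le> card (balanced_sets m n)" (is "sum ?c ?I \<le> _")
proof -
  let ?P = "{..<m}" and ?Q = "{m..<m + n}"
  define S where "S J x = {X. X \<subseteq> J \<and> card X = x}" for J :: "nat set" and x
  define T where "T = (\<lambda>(x\<^sub>1, x\<^sub>2, x\<^sub>3, x\<^sub>4). S ?P x\<^sub>1 \<times> S ?P x\<^sub>2 \<times> S ?Q x\<^sub>3 \<times> S ?Q x\<^sub>4)"
  define g :: "nat set \<times> nat set \<times> nat set \<times> nat set \<Rightarrow> (nat \<times> nat) set" where
    "g = (\<lambda>(X\<^sub>1, X\<^sub>2, X\<^sub>3, X\<^sub>4). {0} \<times> (X\<^sub>1 \<union> X\<^sub>3) \<union> {1} \<times> (X\<^sub>2 \<union> X\<^sub>4))"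
  have fin_S: "finite (S J x)" if "finite J" for J x
    using that by (simp add: S_def)
  have fin_T: "finite (T t)" for t
    by (auto simp: T_def fin_S split: prod.split)
  have fin_I: "finite ?I"
    by (rule finite_subset[of _ "{1..m - 1} \<times> {1..m - 1} \<times> {1..n - 1} \<times> {1..n - 1}"]) auto
  \<comment> \<open>The families \<open>T t\<close> are disjoint because the sizes of the four
    traces determine \<open>t\<close>.\<close>
  have "card (\<Union> (T ` ?I)) = (\<Sum>t\<in>?I. card (T t))"
    by (rule card_UN_disjoint) (use fin_I fin_T in \<open>auto simp: T_def S_def\<close>)
  also have "\<dots> = sum ?c ?I"
    by (rule sum.cong) (auto simp: T_def S_def card_cartesian_product n_subsets)
  finally have card_T: "card (\<Union> (T ` ?I)) = sum ?c ?I" .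
  have "inj_on g (\<Union> (T ` ?I))"
  proof (rule inj_on_inverseI)
    fix Y assume Y: "Y \<in> \<Union> (T ` ?I)"
    obtain X\<^sub>1 X\<^sub>2 X\<^sub>3 X\<^sub>4 where eq: "Y = (X\<^sub>1, X\<^sub>2, X\<^sub>3, X\<^sub>4)" by (cases Y) auto
    have "X\<^sub>1 \<subseteq> ?P" "X\<^sub>2 \<subseteq> ?P" "X\<^sub>3 \<subseteq> ?Q" "X\<^sub>4 \<subseteq> ?Q"
      using Y by (auto simp: eq T_def S_def)
    \<comment> \<open>The inverse of \<open>g\<close> cuts each row at column
      \<open>m\<close>.\<close>
    then show "(\<lambda>Z. ({j. (0, j) \<in> Z \<and> j < m}, {j. (1, j) \<in> Z \<and> j < m},
        {j. (0, j) \<in> Z \<and> m \<le> j}, {j. (1, j) \<in> Z \<and> m \<le> j})) (g Y) = Y"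
      by (fastforce simp: eq g_def)
  qed
  moreover have "g ` (\<Union> (T ` ?I)) \<subseteq> balanced_sets m n"
  proof
    fix Z assume "Z \<in> g ` (\<Union> (T ` ?I))"
    then obtain X\<^sub>1 X\<^sub>2 X\<^sub>3 X\<^sub>4 where Z: "Z = g (X\<^sub>1, X\<^sub>2, X\<^sub>3, X\<^sub>4)"
      and X: "X\<^sub>1 \<subseteq> ?P" "X\<^sub>2 \<subseteq> ?P" "X\<^sub>3 \<subseteq> ?Q" "X\<^sub>4 \<subseteq> ?Q"
      and sum: "card X\<^sub>1 + card X\<^sub>2 + card X\<^sub>3 + card X\<^sub>4 = m + n"
      and c: "card X\<^sub>1 \<in> {1..m - 1}" "card X\<^sub>2 \<in> {1..m - 1}" "card X\<^sub>3 \<in> {1..n - 1}"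
        "card X\<^sub>4 \<in> {1..n - 1}"
      by (auto simp: T_def S_def)
    have fin: "finite X\<^sub>1" "finite X\<^sub>2" "finite X\<^sub>3" "finite X\<^sub>4"
      using X finite_subset by blast+
    have "card Z = card (X\<^sub>1 \<union> X\<^sub>3) + card (X\<^sub>2 \<union> X\<^sub>4)"
      unfolding Z g_def prod.case
      by (subst card_Un_disjoint) (use fin in \<open>auto simp: card_cartesian_product\<close>)
    also have "card (X\<^sub>1 \<union> X\<^sub>3) = card X\<^sub>1 + card X\<^sub>3"
      by (rule card_Un_disjoint) (use fin X in force)+
    also have "card (X\<^sub>2 \<union> X\<^sub>4) = card X\<^sub>2 + card X\<^sub>4"
      by (rule card_Un_disjoint) (use fin X in force)+
    finally have "card Z = m + n" using sum by simp
    moreover have "Z \<subseteq> pairs (m + n)"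
      using X by (fastforce simp: Z g_def pairs_def)
    moreover have "(\<exists>j. (i, j) \<in> Z \<and> (j < m \<longleftrightarrow> b)) \<and> (\<exists>j<m + n. (i, j) \<notin> Z \<and> (j < m \<longleftrightarrow> b))"
      if ib: "i \<in> {0, 1}" for i b
    proof -
      have block: "\<exists>x\<in>J. \<exists>y\<in>J. x \<in> Y \<and> y \<notin> Y"
        if "Y \<subseteq> J" "card Y \<in> {1..card J - 1}" for Y J :: "nat set"
      proof -
        have "Y \<noteq> {}" "Y \<noteq> J" using that(2) by auto
        then show ?thesis using that(1) by blast
      qed
      obtain x\<^sub>1 y\<^sub>1 x\<^sub>2 y\<^sub>2 x\<^sub>3 y\<^sub>3 x\<^sub>4 y\<^sub>4 where
        1: "x\<^sub>1 < m" "y\<^sub>1 < m" "x\<^sub>1 \<in> X\<^sub>1" "y\<^sub>1 \<notin> X\<^sub>1" and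
        2: "x\<^sub>2 < m" "y\<^sub>2 < m" "x\<^sub>2 \<in> X\<^sub>2" "y\<^sub>2 \<notin> X\<^sub>2" and
        3: "m \<le> x\<^sub>3" "m \<le> y\<^sub>3" "y\<^sub>3 < m + n" "x\<^sub>3 \<in> X\<^sub>3" "y\<^sub>3 \<notin> X\<^sub>3" and
        4: "m \<le> x\<^sub>4" "m \<le> y\<^sub>4" "y\<^sub>4 < m + n" "x\<^sub>4 \<in> X\<^sub>4" "y\<^sub>4 \<notin> X\<^sub>4"
        using block[OF X(1)] block[OF X(2)] block[OF X(3)] block[OF X(4)] c by auto
      have low: "j \<notin> X\<^sub>3" "j \<notin> X\<^sub>4" if "j < m" for j using X that by auto
      have high: "j \<notin> X\<^sub>1" "j \<notin> X\<^sub>2" if "m \<le> j" for j using X that by auto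
      have "(0, x\<^sub>1) \<in> Z" "(0, y\<^sub>1) \<notin> Z" "(1, x\<^sub>2) \<in> Z" "(1, y\<^sub>2) \<notin> Z"
        "(0, x\<^sub>3) \<in> Z" "(0, y\<^sub>3) \<notin> Z" "(1, x\<^sub>4) \<in> Z" "(1, y\<^sub>4) \<notin> Z"
        using 1 2 3 4 low high by (simp_all add: Z g_def)
      then show ?thesis
        using ib 1(1,2) 2(1,2) 3(1-3) 4(1-3) by (cases b) (metis insertE leD not_less singletonD trans_less_add1)+
    qed
    ultimately show "Z \<in> balanced_sets m n" by (auto simp: balanced_sets_def)
  qed
  ultimately have "card (\<Union> (T ` ?I)) \<le> card (balanced_sets m n)"
    by (intro card_inj_on_le finite_balanced_sets)
  then show ?thesis using card_T by simp
qed

section \<open>The family\<close>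

text \<open>\<open>J\<close> holds one column from each block, so row 0 contains a single point of
  each block and row 1 omits a single point of each. If \<open>i\<close> has no counterpart in the
  second block, as for \<open>i = n\<close> when \<open>m = n + 1\<close>, column \<open>m\<close>
  is the default.\<close>

definition separating_set :: "nat \<Rightarrow> nat \<Rightarrow> nat \<Rightarrow> (nat \<times> nat) set" where
  "separating_set m n i =
    (let J = {i, m + (if i < n then i else 0)} in {0} \<times> J \<union> {1} \<times> ({..<m + n} - J))"

text \<open>The two rows contribute 2 and \<open>m + n - 2\<close> points. As both block sizes are
  at least 2, \<open>J\<close> also leaves a column of each block uncovered.\<close>

lemma separating_set_balanced:
  assumes "2 \<le> m" "2 \<le> n" "i < m"
  shows "separating_set m n i \<in> balanced_sets m n"
proof -
  define j where "j = m + (if i < n then i else 0)"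
  have j: "m \<le> j" "j < m + n" using assms by (auto simp: j_def)
  have S: "separating_set m n i = {0} \<times> {i, j} \<union> {1} \<times> ({..<m + n} - {i, j})"
    by (simp add: separating_set_def j_def Let_def)
  obtain i' j' where ij': "i' < m" "i' \<noteq> i" "m \<le> j'" "j' < m + n" "j' \<noteq> j"
  proof
    show "(if i = 0 then 1 else 0) < m" "(if i = 0 then 1 else 0) \<noteq> i"
      "m \<le> (if j = m then m + 1 else m)" "(if j = m then m + 1 else m) < m + n"
      "(if j = m then m + 1 else m) \<noteq> j"
      using assms by auto
  qed
  have card_row: "card ({a} \<times> J) = card J" for a :: nat and J :: "nat set"
    by (simp add: card_cartesian_product)
  have "card (separating_set m n i) = card {i, j} + card ({..<m + n} - {i, j})"
    unfolding S by (subst card_Un_disjoint) (simp_all only: card_row, auto)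
  also have "\<dots> = m + n"
    using assms j by (subst card_Diff_subset) auto
  finally have "card (separating_set m n i) = m + n" .
  moreover have "separating_set m n i \<subseteq> pairs (m + n)"
    using assms j by (auto simp: S pairs_def)
  moreover have "(\<exists>j. (a, j) \<in> separating_set m n i \<and> (j < m \<longleftrightarrow> b)) \<and>
      (\<exists>j<m + n. (a, j) \<notin> separating_set m n i \<and> (j < m \<longleftrightarrow> b))"
    if "a \<in> {0, 1}" for a b
  proof -
    \<comment> \<open>In the block selected by \<open>b\<close>, \<open>x\<close> lies in
      \<open>J\<close> and \<open>y\<close> outside; the two rows use them in opposite
      roles.\<close>
    define x y where "x = (if b then i else j)" and "y = (if b then i' else j')"
    have xy: "x < m \<longleftrightarrow> b" "y < m \<longleftrightarrow> b" "x < m + n" "y < m + n" "x \<in> {i, j}" "y \<notin> {i, j}"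
      using assms j ij' by (auto simp: x_def y_def)
    show ?thesis
    proof (cases "a = 0")
      case True
      then have "(a, x) \<in> separating_set m n i" "(a, y) \<notin> separating_set m n i"
        using xy by (auto simp: S)
      then show ?thesis using xy by blast
    next
      case False
      then have "(a, y) \<in> separating_set m n i" "(a, x) \<notin> separating_set m n i"
        using xy that by (auto simp: S)
      then show ?thesis using xy by blast
    qed
  qed
  ultimately show ?thesis by (auto simp: balanced_sets_def)
qed

text \<open>The family \<open>F\<close> lies between the separating sets with A and B, at most
  \<open>m + 2\<close> sets, and all balanced sets with A and B, exactly two more than the balanced
  ones. This is where both bounds on \<open>q\<close> come from.\<close>

lemma orientation_number_if_le_card_balanced_sets:
  assumes "2 \<le> n" "n \<le> m" and q: "m + 2 \<le> q" "q \<le> card (balanced_sets m n) + 2"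
  shows "orientation_number (complete_multipartite [m + n, m + n, q]) = 2"
proof -
  let ?A = "side (m + n) 0" and ?B = "side (m + n) 1" and ?S = "separating_set m n ` {..<m}"
  have meet: "\<exists>j. (i, j) \<in> X \<and> (j < m \<longleftrightarrow> b)" and miss: "\<exists>j<m + n. (i, j) \<notin> X \<and> (j < m \<longleftrightarrow> b)"
    if "X \<in> balanced_sets m n" "i \<in> {0, 1}" for X i b
    using that unfolding balanced_sets_def by blast+
  have "(1, j) \<notin> ?A" "(0, j) \<notin> ?B" for j by (simp_all add: side_def)
  moreover have "(0, 0) \<in> ?A" using assms(1) by (simp add: side_def)
  ultimately have disj: "?A \<notin> balanced_sets m n" "?B \<notin> balanced_sets m n" "?A \<noteq> ?B"
    using meet[of ?A 1] meet[of ?B 0] by blast+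
  \<comment> \<open>A and B each avoid a whole row, hence are not balanced and add exactly
    two.\<close>
  have card_max: "card (balanced_sets m n \<union> {?A, ?B}) = card (balanced_sets m n) + 2"
    using disj by (subst card_Un_disjoint) (auto simp: finite_balanced_sets)
  have "card (?S \<union> {?A, ?B}) \<le> card ?S + card {?A, ?B}" by (rule card_Un_le)
  also have "\<dots> \<le> m + 2"
    using card_image_le[of "{..<m}" "separating_set m n"] disj(3) by simp
  finally have "card (?S \<union> {?A, ?B}) \<le> q" using q(1) by simp
  moreover have "?S \<union> {?A, ?B} \<subseteq> balanced_sets m n \<union> {?A, ?B}"
    using separating_set_balanced[OF _ assms(1)] assms(1,2) by auto
  moreover have "finite (balanced_sets m n \<union> {?A, ?B})" by (simp add: finite_balanced_sets)
  ultimately obtain F where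
    F: "?S \<union> {?A, ?B} \<subseteq> F" "F \<subseteq> balanced_sets m n \<union> {?A, ?B}" "card F = q"
    using exists_subset_between[of "?S \<union> {?A, ?B}" q "balanced_sets m n \<union> {?A, ?B}"] q(2) card_max
    by auto
  have X_cases: "X \<in> balanced_sets m n \<or> X = ?A \<or> X = ?B" if "X \<in> F" for X
    using F(2) that by blast
  have F_sub: "X \<subseteq> pairs (m + n)" and F_card: "card X = m + n" if "X \<in> F" for X
    using X_cases[OF that]
    by (auto simp add: side_def pairs_def card_cartesian_product)
      (auto simp add: balanced_sets_def pairs_def)
  have fin: "finite (pairs (m + n))" by (simp add: pairs_def)
  have side_block: "\<exists>j<m + n. j < m \<longleftrightarrow> b" for b
    using assms(1,2) by (cases b) (auto intro: exI[of _ 0] exI[of _ m])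
  show ?thesis
  proof (rule orientation_number_eq_2[where F = F and m = m])
    show "finite F"
      by (rule finite_subset[OF F(2)]) (simp add: finite_balanced_sets)
    show "card F = q" by (rule F(3))
    show "X \<subseteq> pairs (m + n)" if "X \<in> F" for X by (rule F_sub[OF that])
    show "\<not> X \<subseteq> Y" if "X \<in> F" "Y \<in> F" "X \<noteq> Y" for X Y
      using that F_sub F_card card_subset_eq finite_subset[OF F_sub fin] by metis
    show "\<exists>w'\<in>X. block_arc m w' w" if X: "X \<in> F" and w: "w \<in> pairs (m + n) - X" for X w
    proof -
      have i: "fst w \<in> {0, 1}" using w by (auto simp: pairs_def)
      \<comment> \<open>The condition on \<open>j\<close> describes the block preceding that of
        \<open>w\<close> on the cycle; \<open>1 - fst w\<close> switches the row.\<close>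
      have "\<exists>j. (1 - fst w, j) \<in> X \<and> (j < m \<longleftrightarrow> (if fst w = 0 then \<not> snd w < m else snd w < m))"
        using X_cases[OF X]
      proof (elim disjE)
        assume "X \<in> balanced_sets m n"
        then show ?thesis using i by (intro meet) auto
      next
        assume X: "X = ?A"
        then have "fst w = 1" using w by (cases w) (auto simp: side_def pairs_def)
        then show ?thesis using side_block[of "snd w < m"] X by (simp add: side_def)
      next
        assume X: "X = ?B"
        then have "fst w = 0" using w by (cases w) (auto simp: side_def pairs_def)
        then show ?thesis using side_block[of "\<not> snd w < m"] X by (simp add: side_def)
      qed
      then obtain j where j: "(1 - fst w, j) \<in> X"
        "j < m \<longleftrightarrow> (if fst w = 0 then \<not> snd w < m else snd w < m)" by blast
      then have "block_arc m (1 - fst w, j) w" using i by (auto simp: block_arc_def)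
      then show ?thesis using j(1) by blast
    qed
    show "\<exists>w'\<in>pairs (m + n) - X. block_arc m w w'" if X: "X \<in> F" and w: "w \<in> X" for X w
    proof -
      have i: "fst w \<in> {0, 1}" using w F_sub[OF X] by (auto simp: pairs_def)
      \<comment> \<open>Here \<open>j\<close> is sought in the block following that of
        \<open>w\<close>.\<close>
      have "\<exists>j<m + n. (1 - fst w, j) \<notin> X \<and>
          (j < m \<longleftrightarrow> (if fst w = 0 then snd w < m else \<not> snd w < m))"
        using X_cases[OF X]
      proof (elim disjE)
        assume "X \<in> balanced_sets m n"
        then show ?thesis using i by (intro miss) auto
      next
        assume X: "X = ?A"
        then have "fst w = 0" using w by (cases w) (auto simp: side_def)
        then show ?thesis using side_block[of "snd w < m"] X by (simp add: side_def)
      next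
        assume X: "X = ?B"
        then have "fst w = 1" using w by (cases w) (auto simp: side_def)
        then show ?thesis using side_block[of "\<not> snd w < m"] X by (simp add: side_def)
      qed
      then obtain j where j: "j < m + n" "(1 - fst w, j) \<notin> X"
        "j < m \<longleftrightarrow> (if fst w = 0 then snd w < m else \<not> snd w < m)" by blast
      then have "block_arc m w (1 - fst w, j)" "(1 - fst w, j) \<in> pairs (m + n)"
        using i by (auto simp: block_arc_def pairs_def)
      then show ?thesis using j(2) by blast
    qed
    show "\<exists>X\<in>F. u \<notin> X \<and> v \<in> X"
      if uv: "u \<in> pairs (m + n)" "v \<in> pairs (m + n)" "u \<noteq> v"
        and same: "\<not> (fst u = fst v \<and> (snd u < m) \<noteq> (snd v < m))" for u v
    proof (cases "fst u = fst v")
      case False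
      \<comment> \<open>The partite set containing \<open>v\<close>, itself a member of
        \<open>F\<close>, separates the two vertices.\<close>
      then have "u \<notin> side (m + n) (fst v)" "v \<in> side (m + n) (fst v)" "fst v \<in> {0, 1}"
        using uv by (auto simp: side_def pairs_def)
      then show ?thesis using F(1) by auto
    next
      case True
      \<comment> \<open>Row 0 of a separating set is \<open>J\<close> and row 1 its complement, so
        \<open>J\<close> must catch the column of \<open>v\<close> in row 0 but that of
        \<open>u\<close> in row 1. The index \<open>k\<close> is chosen so that \<open>j\<close> is
        in \<open>J\<close>.\<close>
      define j where "j = (if fst v = 0 then snd v else snd u)"
      define k where "k = (if j < m then j else j - m)"
      have *: "(snd u < m) = (snd v < m)" "(j < m) = (snd v < m)" "j < m + n"
        using True same uv by (auto simp: j_def pairs_def)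
      have "k < m" using * assms(2) by (auto simp: k_def)
      moreover have "u \<notin> separating_set m n k \<and> v \<in> separating_set m n k"
      proof -
        define J where "J = {k, m + (if k < n then k else 0)}"
        \<comment> \<open>Since \<open>J\<close> has one column per block, within the block of
          \<open>j\<close> it contains \<open>j\<close> alone.\<close>
        have J: "i \<in> J \<longleftrightarrow> i = j" if "i < m \<longleftrightarrow> j < m" for i
          using that *(3) assms(2) by (auto simp: J_def k_def)
        have S: "separating_set m n k = {0} \<times> J \<union> {1} \<times> ({..<m + n} - J)"
          by (simp add: separating_set_def J_def Let_def)
        have "snd u \<noteq> snd v" using True uv(3) by (simp add: prod_eq_iff)
        moreover have "snd u \<in> J \<longleftrightarrow> snd u = j" "snd v \<in> J \<longleftrightarrow> snd v = j" using * by (simp_all add: J)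
        moreover have "snd v < m + n" "fst v = 0 \<or> fst v = 1" using uv(2) by (auto simp: pairs_def)
        ultimately show ?thesis
          using True by (auto simp: S mem_Times_iff j_def)
      qed
      ultimately show ?thesis using F(1) by blast
    qed
    show "0 < m" "m < m + n" using assms(1,2) by auto
  qed
qed

section \<open>Block sizes for even and odd p\<close>

theorem theorem3p11:
  fixes p q :: nat
  assumes "p \<ge> 4"
    and "(even p \<and> p + 2 \<le> q \<and> q \<le> Phi_even p + 2) \<or>
         (odd p \<and> p + 3 \<le> q \<and> q \<le> Phi_odd p + 2)"
  shows "orientation_number (complete_multipartite [p, p, q]) = 2"
proof (cases "even p")
  case True
  \<comment> \<open>Two equal halves, of size at least 2 as \<open>p\<close> is at least 4;
    \<open>p + 2\<close> covers the required \<open>m + 2\<close>.\<close>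
  let ?n = "p div 2"
  have p: "?n + ?n = p" using True by auto
  have "Phi_even p \<le> card (balanced_sets ?n ?n)"
    using card_balanced_sets_ge[of ?n ?n] by (simp add: Phi_even_def Let_def p)
  then show ?thesis
    using orientation_number_if_le_card_balanced_sets[of ?n ?n q, unfolded p] assms True by auto
next
  case False
  \<comment> \<open>The first blocks get the extra point, so their trace sizes range over
    \<open>{1..?n}\<close>, as in \<open>Phi_odd\<close>. Oddness makes \<open>p\<close> at least 5,
    hence \<open>?n\<close> at least 2.\<close>
  let ?n = "p div 2"
  have p: "?n + 1 + ?n = p" using False by presburger
  have "Phi_odd p \<le> card (balanced_sets (?n + 1) ?n)"
    using card_balanced_sets_ge[of "?n + 1" ?n] unfolding Phi_odd_def Let_def p by simp
  then show ?thesis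
    using orientation_number_if_le_card_balanced_sets[of ?n "?n + 1" q, unfolded p] assms False
    by auto
qed

end
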